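(* Let $m\ge 1$ be an integer, let $q_1<q_2<\cdots<q_m$ be prime numbers, let $\alpha_1,\dots,\alpha_m$ be positive integers, and let $\beta_1,\dots,\beta_m$ be a permutation of $\alpha_1,\dots,\alpha_m$ with $\beta_1\ge\beta_2\ge\cdots\ge\beta_m$. Then $$e^{\gamma}\log\log\prod_{k=1}^{m}q_k^{\alpha_k}-\prod_{k=1}^{m}\frac{q_k-\frac{1}{q_k^{\alpha_k}}}{q_k-1}\ \ge\ e^{\gamma}\log\log\prod_{k=1}^{m}p_k^{\beta_k}-\prod_{k=1}^{m}\frac{p_k-\frac{1}{p_k^{\beta_k}}}{p_k-1}.$$
   Context: $p_k$ denotes the $k$-th prime number in ascending order ($p_1=2,p_2=3,p_3=5,\dots$), $\gamma$ is Euler's constant, and $\log$ is the natural logarithm. *)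

theory Defs
  imports
    "HOL-Analysis.Analysis"
    "HOL-Computational_Algebra.Primes"
    "HOL-Combinatorics.Permutations"
    "HOL-Library.Infinite_Set"
begin

(* enumerate lists an infinite set of naturals in increasing order starting from index 0,
   while p_1 = 2, hence the shift; the index 0 is not meaningful here. *)
definition nth_prime :: "nat \<Rightarrow> nat" where
  "nth_prime k = enumerate {p. prime p} (k - 1)"

lemma nth_prime_1: "nth_prime 1 = 2"
  unfolding nth_prime_def
  by (auto simp: enumerate_0 intro!: Least_equality dest: prime_ge_2_nat)

lemma nth_prime_strict_mono_on: "strict_mono_on {1..} nth_prime"
  unfolding nth_prime_def
  by (intro strict_mono_onI enumerate_mono) (auto simp: primes_infinite)

lemma nth_prime_image: "nth_prime ` {1..} = {p. prime p}"
proof -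
  have "nth_prime ` {1..} = enumerate {p. prime p} ` ((\<lambda>k. k - 1) ` {1..})"
    unfolding image_image nth_prime_def ..
  also have "(\<lambda>k::nat. k - 1) ` {1..} = UNIV"
    by (auto simp: image_iff intro!: bexI[of _ "Suc _"])
  also have "range (enumerate {p::nat. prime p}) = {p. prime p}"
    by (rule range_enumerate) (simp add: primes_infinite)
  finally show ?thesis .
qed

end

theory Submission
  imports Defs
begin

text \<open>
  Put \<open>n = (\<Prod>k=1..m. q k ^ \<alpha> k)\<close> and \<open>n' = (\<Prod>k=1..m. nth_prime k ^ \<beta> k)\<close>, and let \<open>s(n)\<close> be the sum
  of the divisors of \<open>n\<close>. The two products that are subtracted are \<open>s(n)/n\<close> and \<open>s(n')/n'\<close>. The
  inequality splits into two independent ones, \<open>n' \<le> n\<close> and \<open>s(n)/n \<le> s(n')/n'\<close>; of the constant in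
  front of the iterated logarithm only the sign matters.

  Both are instances of one rearrangement principle, \<open>prod_layers_le_first_primes\<close>. The factor
  that a prime power \<open>p ^ a\<close> contributes can be built up one exponent at a time:
  \<open>1 / p ^ a\<close> is a product of \<open>a\<close> factors \<open>1 / p\<close>, and \<open>(p - 1 / p ^ a) / (p - 1)\<close> is the product
  over \<open>i = 1..a\<close> of \<open>1 + 1 / (p + p ^ 2 + \<dots> + p ^ i)\<close>, by \<open>prime_power_abundancy_eq_prod\<close>.
  In both cases the \<open>i\<close>-th factor decreases when \<open>p\<close> grows. Now multiply over all primes, but collect
  the factors by \<open>i\<close> rather than by \<open>p\<close>. The layer \<open>i\<close> of \<open>n\<close> runs over the primes \<open>q k\<close> with
  \<open>i \<le> \<alpha> k\<close>. The layer \<open>i\<close> of \<open>n'\<close> runs over equally many primes, because \<open>\<beta>\<close> rearranges \<open>\<alpha>\<close>, and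
  these are the smallest ones, because \<open>\<beta>\<close> is decreasing. Hence each layer of \<open>n'\<close> has the larger
  product, by \<open>prod_primes_le_prod_first_primes\<close>. In this way the exchange of the primes and
  the sorting of the exponents are dealt with in a single step.
\<close>

section \<open>Products over sets of primes\<close>

lemma prime_nth_prime: "k \<ge> 1 \<Longrightarrow> prime (nth_prime k)"
  using nth_prime_image by auto

text \<open>If the largest of \<open>c\<close> primes were below the \<open>c\<close>-th prime, all of them would lie among the
  first \<open>c - 1\<close> primes.\<close>

lemma nth_prime_card_le_Max:
  assumes "finite P" "P \<noteq> {}" "\<And>p. p \<in> P \<Longrightarrow> prime p"
  shows "nth_prime (card P) \<le> Max P"
proof (rule ccontr)
  assume "\<not> nth_prime (card P) \<le> Max P"
  hence less: "p < nth_prime (card P)" if "p \<in> P" for p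
    using that assms(1) Max_ge[of P p] by linarith
  have pos: "card P \<ge> 1"
    using assms(1,2) by (simp add: Suc_leI card_gt_0_iff)
  have "P \<subseteq> nth_prime ` {1..<card P}"
  proof
    fix p assume "p \<in> P"
    then obtain k where k: "k \<ge> 1" "p = nth_prime k"
      using assms(3) nth_prime_image by (metis (mono_tags, lifting) atLeast_iff image_iff mem_Collect_eq)
    have "k < card P"
    proof (rule ccontr)
      assume "\<not> k < card P"
      hence "nth_prime (card P) \<le> nth_prime k"
        using strict_mono_on_leD[OF nth_prime_strict_mono_on, of "card P" k] pos k(1) by simp
      with less[OF \<open>p \<in> P\<close>] k(2) show False by simp
    qed
    with k show "p \<in> nth_prime ` {1..<card P}" by simp
  qed
  hence "card P \<le> card (nth_prime ` {1..<card P})"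
    by (intro card_mono) auto
  also have "\<dots> \<le> card P - 1"
    using card_image_le[of "{1..<card P}" nth_prime] by simp
  finally show False using pos by simp
qed

text \<open>The largest of \<open>c\<close> primes is compared with the \<open>c\<close>-th prime; what remains are \<open>c - 1\<close> primes
  to be compared with the first \<open>c - 1\<close>.\<close>

lemma prod_primes_le_prod_first_primes:
  fixes h :: "nat \<Rightarrow> real"
  assumes "finite P" "\<And>p. p \<in> P \<Longrightarrow> prime p"
    and nonneg: "\<And>p. prime p \<Longrightarrow> 0 \<le> h p"
    and anti: "\<And>p r. prime p \<Longrightarrow> prime r \<Longrightarrow> p \<le> r \<Longrightarrow> h r \<le> h p"
  shows "(\<Prod>p\<in>P. h p) \<le> (\<Prod>k=1..card P. h (nth_prime k))"
  using assms(1,2)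
proof (induction "card P" arbitrary: P)
  case 0
  thus ?case by simp
next
  case (Suc c)
  define x where "x = Max P"
  have "P \<noteq> {}" using Suc.hyps(2) by auto
  hence x: "x \<in> P" using Suc.prems(1) by (simp add: x_def)
  have c: "c = card (P - {x})"
    using Suc.hyps(2) Suc.prems(1) x by simp
  have "nth_prime (Suc c) \<le> x"
    unfolding x_def Suc.hyps(2)
    by (rule nth_prime_card_le_Max) (use Suc.prems \<open>P \<noteq> {}\<close> in auto)
  hence "h x \<le> h (nth_prime (Suc c))"
    using Suc.prems(2) x by (intro anti prime_nth_prime) auto
  moreover have "(\<Prod>p\<in>P - {x}. h p) \<le> (\<Prod>k=1..c. h (nth_prime k))"
    using Suc.hyps(1)[OF c] Suc.prems c by simp
  ultimately have "h x * (\<Prod>p\<in>P - {x}. h p)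
      \<le> h (nth_prime (Suc c)) * (\<Prod>k=1..c. h (nth_prime k))"
    using Suc.prems(2) by (intro mult_mono prod_nonneg nonneg prime_nth_prime) auto
  thus ?case
    using Suc.prems(1) x Suc.hyps(2)[symmetric] by (simp add: prod.remove[of P x] mult.commute)
qed

section \<open>Rearrangement by layers\<close>

lemma downward_closed_eq_initial_segment:
  fixes T :: "nat set"
  assumes "T \<subseteq> {1..m}" and down: "\<And>j k. k \<in> T \<Longrightarrow> 1 \<le> j \<Longrightarrow> j \<le> k \<Longrightarrow> j \<in> T"
  shows "T = {1..card T}"
proof (cases "T = {}")
  case False
  have fin: "finite T" using assms(1) finite_subset by blast
  have "T = {1..Max T}"
  proof (intro equalityI subsetI)
    fix j assume "j \<in> T"
    thus "j \<in> {1..Max T}" using assms(1) fin by auto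
  next
    fix j assume "j \<in> {1..Max T}"
    thus "j \<in> T" using down[OF Max_in[OF fin False], of j] by simp
  qed
  moreover from this have "card T = Max T"
    by (metis card_atLeastAtMost diff_Suc_1)
  ultimately show ?thesis by simp
qed simp

text \<open>Here \<open>r i p\<close> is the factor by which the contribution of \<open>p\<close> grows when its exponent is raised
  from \<open>i - 1\<close> to \<open>i\<close>.\<close>

lemma prod_layers_le_first_primes:
  fixes r :: "nat \<Rightarrow> nat \<Rightarrow> real" and q \<alpha> \<beta> \<sigma> :: "nat \<Rightarrow> nat"
  assumes prime: "\<And>k. k \<in> {1..m} \<Longrightarrow> prime (q k)"
    and inj: "inj_on q {1..m}"
    and perm: "\<sigma> permutes {1..m}"
    and \<beta>: "\<And>k. k \<in> {1..m} \<Longrightarrow> \<beta> k = \<alpha> (\<sigma> k)"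
    and dec: "antimono_on {1..m} \<beta>"
    and nonneg: "\<And>i p. i \<ge> 1 \<Longrightarrow> prime p \<Longrightarrow> 0 \<le> r i p"
    and anti: "\<And>i p s. i \<ge> 1 \<Longrightarrow> prime p \<Longrightarrow> prime s \<Longrightarrow> p \<le> s \<Longrightarrow> r i s \<le> r i p"
  shows "(\<Prod>k=1..m. \<Prod>i=1..\<alpha> k. r i (q k)) \<le> (\<Prod>k=1..m. \<Prod>i=1..\<beta> k. r i (nth_prime k))"
proof -
  define M where "M = Max (\<alpha> ` {1..m})"
  have \<alpha>_le: "\<alpha> k \<le> M" if "k \<in> {1..m}" for k
    using that by (simp add: M_def)
  have \<sigma>_in: "\<sigma> k \<in> {1..m}" if "k \<in> {1..m}" for k
    using permutes_in_image[OF perm] that by blast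
  have \<beta>_le: "\<beta> k \<le> M" if "k \<in> {1..m}" for k
    using that \<alpha>_le \<sigma>_in \<beta> by simp
  have by_layers: "(\<Prod>k=1..m. \<Prod>i=1..e k. r i (f k)) = (\<Prod>i=1..M. \<Prod>k | k \<in> {1..m} \<and> i \<le> e k. r i (f k))"
    if "\<And>k. k \<in> {1..m} \<Longrightarrow> e k \<le> M" for e f :: "nat \<Rightarrow> nat"
  proof -
    have "{1..e k} = {i. i \<in> {1..M} \<and> i \<le> e k}" if "k \<in> {1..m}" for k
      using \<open>\<And>k. k \<in> {1..m} \<Longrightarrow> e k \<le> M\<close>[OF that] by auto
    hence "(\<Prod>k=1..m. \<Prod>i=1..e k. r i (f k)) = (\<Prod>k=1..m. \<Prod>i | i \<in> {1..M} \<and> i \<le> e k. r i (f k))"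
      by (intro prod.cong) auto
    also have "\<dots> = (\<Prod>i=1..M. \<Prod>k | k \<in> {1..m} \<and> i \<le> e k. r i (f k))"
      by (rule prod.swap_restrict) auto
    finally show ?thesis .
  qed
  have layer: "0 \<le> (\<Prod>k | k \<in> {1..m} \<and> i \<le> \<alpha> k. r i (q k)) \<and>
      (\<Prod>k | k \<in> {1..m} \<and> i \<le> \<alpha> k. r i (q k)) \<le> (\<Prod>k | k \<in> {1..m} \<and> i \<le> \<beta> k. r i (nth_prime k))"
    if "i \<ge> 1" for i
  proof -
    \<comment> \<open>\<open>S\<close> and \<open>T\<close> are the indices of the primes in layer \<open>i\<close>, before and after the rearrangement.\<close>
    define S where "S = {k. k \<in> {1..m} \<and> i \<le> \<alpha> k}"
    define T where "T = {k. k \<in> {1..m} \<and> i \<le> \<beta> k}"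
    have "S = \<sigma> ` T"
    proof (intro equalityI subsetI)
      fix k assume k: "k \<in> S"
      then obtain j where "j \<in> {1..m}" "k = \<sigma> j"
        using permutes_image[OF perm] unfolding S_def by blast
      with k show "k \<in> \<sigma> ` T" by (auto simp: S_def T_def \<beta>)
    qed (use \<sigma>_in in \<open>auto simp: S_def T_def \<beta>\<close>)
    hence card_S: "card S = card T"
      using permutes_inj_on[OF perm] by (simp add: card_image)
    have T: "T = {1..card T}"
    proof (rule downward_closed_eq_initial_segment)
      show "T \<subseteq> {1..m}" by (auto simp: T_def)
    next
      fix j k assume "k \<in> T" "1 \<le> j" "j \<le> k"
      thus "j \<in> T" using monotone_onD[OF dec, of j k] by (auto simp: T_def)
    qed
    have inj_S: "inj_on q S"
      by (rule inj_on_subset[OF inj]) (auto simp: S_def)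
    have "(\<Prod>k\<in>S. r i (q k)) = (\<Prod>p\<in>q ` S. r i p)"
      using inj_S by (simp add: prod.reindex)
    also have "\<dots> \<le> (\<Prod>k=1..card (q ` S). r i (nth_prime k))"
      by (rule prod_primes_le_prod_first_primes)
         (use prime nonneg[OF that] anti[OF that] in \<open>auto simp: S_def\<close>)
    also have "{1..card (q ` S)} = T"
      using T card_S inj_S by (simp add: card_image)
    finally have "(\<Prod>k\<in>S. r i (q k)) \<le> (\<Prod>k\<in>T. r i (nth_prime k))" .
    moreover have "0 \<le> (\<Prod>k\<in>S. r i (q k))"
      by (intro prod_nonneg nonneg[OF that] ballI prime) (auto simp: S_def)
    ultimately show ?thesis unfolding S_def T_def by simp
  qed
  have "(\<Prod>k=1..m. \<Prod>i=1..\<alpha> k. r i (q k)) = (\<Prod>i=1..M. \<Prod>k | k \<in> {1..m} \<and> i \<le> \<alpha> k. r i (q k))"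
    by (rule by_layers[OF \<alpha>_le])
  also have "\<dots> \<le> (\<Prod>i=1..M. \<Prod>k | k \<in> {1..m} \<and> i \<le> \<beta> k. r i (nth_prime k))"
    by (rule prod_mono, rule layer) simp
  also have "\<dots> = (\<Prod>k=1..m. \<Prod>i=1..\<beta> k. r i (nth_prime k))"
    by (rule by_layers[OF \<beta>_le, symmetric])
  finally show ?thesis .
qed

section \<open>The divisor sum of a prime power\<close>

text \<open>The factor \<open>1 + 1 / (x + \<dots> + x ^ i)\<close> is the quotient of \<open>1 + 1 / x + \<dots> + 1 / x ^ i\<close> by
  \<open>1 + 1 / x + \<dots> + 1 / x ^ (i - 1)\<close>, so the product telescopes to
  \<open>1 + 1 / x + \<dots> + 1 / x ^ a\<close>.\<close>

lemma prime_power_abundancy_eq_prod: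
  fixes x :: real
  assumes "x > 1"
  shows "(x - 1 / x ^ a) / (x - 1) = (\<Prod>i=1..a. 1 + 1 / (\<Sum>l=1..i. x ^ l))"
proof (induction a)
  case 0
  show ?case using assms by simp
next
  case (Suc a)
  have geo: "(\<Sum>l=1..Suc a. x ^ l) = x * (x ^ Suc a - 1) / (x - 1)"
    using assms by (induction a) (simp_all add: field_simps)
  have "x ^ Suc a > 1" using assms by (intro one_less_power) auto
  hence "(x - 1 / x ^ Suc a) / (x - 1)
      = (x - 1 / x ^ a) / (x - 1) * (1 + (x - 1) / (x * (x ^ Suc a - 1)))"
    using assms by (simp add: divide_simps) (simp add: algebra_simps)
  also have "(x - 1) / (x * (x ^ Suc a - 1)) = 1 / (\<Sum>l=1..Suc a. x ^ l)"
    unfolding geo by simp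
  finally show ?case using Suc.IH by (simp only: prod.cl_ivl_Suc) simp
qed

theorem theorem1:
  fixes m :: nat and q \<alpha> \<beta> \<sigma> :: "nat \<Rightarrow> nat"
  assumes "m \<ge> 1"
    and "\<And>k. k \<in> {1..m} \<Longrightarrow> prime (q k)"
    and "strict_mono_on {1..m} q"
    and "\<And>k. k \<in> {1..m} \<Longrightarrow> \<alpha> k > 0"
    and "\<sigma> permutes {1..m}"
    and "\<And>k. k \<in> {1..m} \<Longrightarrow> \<beta> k = \<alpha> (\<sigma> k)"
    and "antimono_on {1..m} \<beta>"
  shows "exp euler_mascheroni * ln (ln (real (\<Prod>k=1..m. q k ^ \<alpha> k)))
           - (\<Prod>k=1..m. (real (q k) - 1 / real (q k) ^ \<alpha> k) / (real (q k) - 1))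
         \<ge> exp euler_mascheroni * ln (ln (real (\<Prod>k=1..m. nth_prime k ^ \<beta> k)))
           - (\<Prod>k=1..m. (real (nth_prime k) - 1 / real (nth_prime k) ^ \<beta> k)
                          / (real (nth_prime k) - 1))"
proof -
  have inj: "inj_on q {1..m}"
    using assms(3) by (rule strict_mono_on_imp_inj_on)
  note rearrange = prod_layers_le_first_primes[OF assms(2) inj assms(5-7)]
  let ?n = "\<Prod>k=1..m. q k ^ \<alpha> k" and ?n' = "\<Prod>k=1..m. nth_prime k ^ \<beta> k"
  \<comment> \<open>The outer logarithm is monotone only on positive arguments, so \<open>n' > 1\<close> is needed.\<close>
  have n'_ge: "?n' \<ge> 2"
  proof -
    have "\<sigma> 1 \<in> {1..m}" using permutes_in_image[OF assms(5), of 1] assms(1) by simp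
    hence "\<beta> 1 \<noteq> 0" using assms(1) assms(4)[of "\<sigma> 1"] assms(6)[of 1] by simp
    hence "2 dvd nth_prime 1 ^ \<beta> 1" by (simp add: nth_prime_1 del: One_nat_def)
    also have "nth_prime 1 ^ \<beta> 1 dvd ?n'"
      using assms(1) by (intro dvd_prodI) auto
    finally have "2 dvd ?n'" .
    moreover have "?n' > 0"
      by (intro prod_pos) (auto intro!: prime_gt_0_nat prime_nth_prime)
    ultimately show ?thesis by (rule dvd_imp_le)
  qed
  have n_pos: "?n > 0"
    by (intro prod_pos ballI zero_less_power prime_gt_0_nat assms(2))
  \<comment> \<open>The factor \<open>p\<close> itself increases with \<open>p\<close>, so the principle is applied to the reciprocal of \<open>n\<close>.\<close>
  have "(\<Prod>k=1..m. \<Prod>i=1..\<alpha> k. 1 / real (q k)) \<le> (\<Prod>k=1..m. \<Prod>i=1..\<beta> k. 1 / real (nth_prime k))"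
    by (rule rearrange[where r = "\<lambda>i p. 1 / real p"]) (auto simp: divide_simps dest: prime_gt_0_nat)
  hence "inverse (real ?n) \<le> inverse (real ?n')"
    by (simp add: power_divide prod_dividef inverse_eq_divide)
  hence "real ?n' \<le> real ?n"
    by (rule inverse_le_imp_le) (use n_pos in linarith)
  moreover have "real ?n' > 1" using n'_ge by linarith
  moreover have "ln (ln x) \<le> ln (ln y)" if "x \<le> y" "1 < x" for x y :: real
    using that by simp
  ultimately have "ln (ln (real ?n')) \<le> ln (ln (real ?n))"
    by blast
  hence log_part: "exp euler_mascheroni * ln (ln (real ?n')) \<le> exp euler_mascheroni * ln (ln (real ?n))"
    by (intro mult_left_mono) auto
  have "(\<Prod>k=1..m. \<Prod>i=1..\<alpha> k. 1 + 1 / (\<Sum>l=1..i. real (q k) ^ l))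
      \<le> (\<Prod>k=1..m. \<Prod>i=1..\<beta> k. 1 + 1 / (\<Sum>l=1..i. real (nth_prime k) ^ l))"
  proof (rule rearrange[where r = "\<lambda>i p. 1 + 1 / (\<Sum>l=1..i. real p ^ l)"])
    fix i p s :: nat
    assume "i \<ge> 1" "prime p" "prime s" "p \<le> s"
    have "(\<Sum>l=1..i. real p ^ l) > 0"
      using \<open>i \<ge> 1\<close> prime_gt_0_nat[OF \<open>prime p\<close>] by (intro sum_pos) auto
    moreover have "(\<Sum>l=1..i. real p ^ l) \<le> (\<Sum>l=1..i. real s ^ l)"
      using \<open>p \<le> s\<close> by (intro sum_mono power_mono) auto
    ultimately show "1 + 1 / (\<Sum>l=1..i. real s ^ l) \<le> 1 + 1 / (\<Sum>l=1..i. real p ^ l)"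
      by (simp add: frac_le)
  qed (auto intro!: add_nonneg_nonneg divide_nonneg_nonneg sum_nonneg)
  also have "(\<Prod>k=1..m. \<Prod>i=1..\<alpha> k. 1 + 1 / (\<Sum>l=1..i. real (q k) ^ l))
      = (\<Prod>k=1..m. (real (q k) - 1 / real (q k) ^ \<alpha> k) / (real (q k) - 1))"
    by (intro prod.cong refl prime_power_abundancy_eq_prod[symmetric])
       (use assms(2) prime_gt_1_nat in auto)
  also have "(\<Prod>k=1..m. \<Prod>i=1..\<beta> k. 1 + 1 / (\<Sum>l=1..i. real (nth_prime k) ^ l))
      = (\<Prod>k=1..m. (real (nth_prime k) - 1 / real (nth_prime k) ^ \<beta> k) / (real (nth_prime k) - 1))"
    by (intro prod.cong refl prime_power_abundancy_eq_prod[symmetric])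
       (use prime_nth_prime prime_gt_1_nat in auto)
  finally show ?thesis using log_part by linarith
qed

end
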